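(* For all $n \geq 8$, \[\text{ex}(n,H_1) = {n+1 \choose 2} - 3.\]
   Context: A $(2\to 1)$-graph (directed hypergraph) is a pair $H=(V,E)$ with $V$ a finite set and $E$ a set of pointed $3$-subsets of $V$: an edge, written $ab\to c$ (same as $ba\to c$), consists of three distinct vertices with head $c$ and tail set $\{a,b\}$. A $3$-subset of $V$ may carry up to three edges. $H$ is $F$-free if there is no injective map $\phi:V(F)\to V(H)$ such that $ab\to c\in E(F)$ implies $\phi(a)\phi(b)\to\phi(c)\in E(H)$. $\text{ex}(n,F)$ is the maximum number of edges of an $F$-free $(2\to1)$-graph on $n$ vertices. $H_1$ is the $(2\to1)$-graph with vertex set $\{a,b,c,d,x\}$ (five distinct vertices) and edges $ax\to b$, $cx\to d$. *)

theory Defs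
  imports Main
begin

text \<open>
  A pointed 3-subset is a pair \<open>(S, h)\<close> with \<open>card S = 3\<close> and \<open>h \<in> S\<close>; the edge
  \<open>ab \<rightarrow> c\<close> is \<open>({a, b, c}, c)\<close>, so its head is \<open>c\<close> and its tail set is \<open>{a, b, c} - {c}\<close>.
\<close>

record 'a hypergraph =
  verts :: "'a set"
  edges :: "('a set \<times> 'a) set"

definition arrow :: "'a \<Rightarrow> 'a \<Rightarrow> 'a \<Rightarrow> 'a set \<times> 'a" where
  "arrow a b c = ({a, b, c}, c)"

definition two_one_graph :: "'a hypergraph \<Rightarrow> bool" where
  "two_one_graph H \<longleftrightarrow>
     finite (verts H) \<and>
     edges H \<subseteq> {(S, h). S \<subseteq> verts H \<and> card S = 3 \<and> h \<in> S}"

definition contains_copy :: "'a hypergraph \<Rightarrow> 'b hypergraph \<Rightarrow> bool" where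
  "contains_copy H F \<longleftrightarrow>
     (\<exists>\<phi>. \<phi> ` verts F \<subseteq> verts H \<and> inj_on \<phi> (verts F) \<and>
        (\<forall>a b c. arrow a b c \<in> edges F \<longrightarrow> arrow (\<phi> a) (\<phi> b) (\<phi> c) \<in> edges H))"

abbreviation free_of :: "'a hypergraph \<Rightarrow> 'b hypergraph \<Rightarrow> bool" where
  "free_of H F \<equiv> \<not> contains_copy H F"

text \<open>
  Up to isomorphism every graph on \<open>n\<close> vertices has its vertices in \<open>nat\<close>.
  The set of edge counts is finite, and it is nonempty as soon as \<open>F\<close> has an edge
  (lemmas below), so \<open>Max\<close> is then a genuine maximum.
\<close>

definition ex :: "nat \<Rightarrow> 'b hypergraph \<Rightarrow> nat" where
  "ex n F = Max {card (edges H) | H :: nat hypergraph.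
                   two_one_graph H \<and> card (verts H) = n \<and> free_of H F}"

text \<open>The vertices \<open>a, b, c, d, x\<close> are \<open>0, 1, 2, 3, 4\<close>.\<close>

definition H\<^sub>1 :: "nat hypergraph" where
  "H\<^sub>1 = \<lparr> verts = {0, 1, 2, 3, 4}, edges = {arrow 0 4 1, arrow 2 4 3} \<rparr>"

lemma two_one_graph_H1: "two_one_graph H\<^sub>1"
  by (auto simp: two_one_graph_def H\<^sub>1_def arrow_def)

lemma finite_edge_counts:
  "finite {card (edges H) | H :: 'a hypergraph.
             two_one_graph H \<and> card (verts H) = n \<and> free_of H F}"
proof (rule finite_subset)
  show "{card (edges H) | H :: 'a hypergraph.
          two_one_graph H \<and> card (verts H) = n \<and> free_of H F} \<subseteq> {..2 ^ n * n}"
  proof clarsimp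
    fix H :: "'a hypergraph"
    assume H: "two_one_graph H"
    have fin: "finite (Pow (verts H) \<times> verts H)"
      using H by (auto simp: two_one_graph_def)
    have "edges H \<subseteq> Pow (verts H) \<times> verts H"
      using H by (auto simp: two_one_graph_def)
    from card_mono[OF fin this] show "card (edges H) \<le> 2 ^ card (verts H) * card (verts H)"
      using H by (simp add: two_one_graph_def card_cartesian_product card_Pow)
  qed
qed simp

lemma edge_counts_nonempty:
  assumes "two_one_graph F" "edges F \<noteq> {}"
  shows "{card (edges H) | H :: nat hypergraph.
            two_one_graph H \<and> card (verts H) = n \<and> free_of H F} \<noteq> {}"
proof -
  from assms obtain S h where Sh: "(S, h) \<in> edges F" "card S = 3" "h \<in> S"
    by (fastforce simp: two_one_graph_def)
  have "card (S - {h}) = 2"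
    using Sh by simp
  then obtain a b where "S - {h} = {a, b}"
    by (auto simp: card_2_iff)
  with Sh have "arrow a b h \<in> edges F"
    by (metis arrow_def insert_Diff insert_commute)
  then have "free_of \<lparr> verts = {..<n}, edges = {} \<rparr> F"
    by (auto simp: contains_copy_def)
  then show ?thesis
    by (auto simp: two_one_graph_def intro!: exI[of _ "\<lparr> verts = {..<n}, edges = {} \<rparr>"])
qed

end

theory Submission
  imports Defs
begin

text \<open>
  For a vertex \<open>x\<close> let \<open>D\<^sub>x\<close> be the digraph of arcs \<open>a \<rightarrow> b\<close> with \<open>ax \<rightarrow> b\<close> an edge, so that the
  numbers of arcs of all \<open>D\<^sub>x\<close> add up to twice the number of edges. The graph is \<open>H\<^sub>1\<close>-free iff no
  \<open>D\<^sub>x\<close> has two disjoint arcs, that is, each \<open>D\<^sub>x\<close> is a star with some centre \<open>f x\<close> or lives on a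
  triangle and has at most 6 arcs. An arc \<open>f x \<rightarrow> b\<close> of \<open>D\<^sub>x\<close> is also the arc \<open>x \<rightarrow> b\<close> of \<open>D\<close> at
  \<open>f x\<close>, which leaves at most one such \<open>b\<close> (two for a triangle) unless \<open>f (f x) = x\<close>. Let \<open>R\<close> be
  the set of these reciprocated \<open>x\<close>. If \<open>R\<close> is empty, every \<open>D\<^sub>x\<close> has at most \<open>n\<close> arcs. Otherwise
  the \<open>D\<^sub>x\<close> with \<open>x \<notin> R\<close> have at most \<open>n - 1\<close> arcs, and those with \<open>x \<in> R\<close> have together at most
  \<open>|R| (n - 2) + 2 (n - |R|)\<close>, since the arcs \<open>x \<rightarrow> f x\<close> with \<open>x \<in> R\<close> contained in a given \<open>D\<^sub>b\<close> come
  from a single pair \<open>{x, f x}\<close>. The total is at most \<open>n\<^sup>2 + n - 3 |R| \<le> n\<^sup>2 + n - 6\<close>.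

  Equality holds for the graph consisting of all edges with head \<open>v\<close> and all edges \<open>vw \<rightarrow> b\<close> and
  \<open>vb \<rightarrow> w\<close>, for two fixed vertices \<open>v\<close> and \<open>w\<close>.
\<close>

section \<open>Copies of \<open>H\<^sub>1\<close>, and digraphs with pairwise intersecting
  arcs\<close>

lemma arrow_commute: "arrow a b c = arrow b a c"
  by (auto simp: arrow_def)

lemma arrow_eq_iff:
  assumes "a \<noteq> c" "b \<noteq> c" "a' \<noteq> c'" "b' \<noteq> c'"
  shows "arrow a b c = arrow a' b' c' \<longleftrightarrow> c = c' \<and> (a = a' \<and> b = b' \<or> a = b' \<and> b = a')"
proof (cases "c = c'")
  case True
  have "{a, b, c} = {a', b', c} \<longleftrightarrow> insert c {a, b} = insert c {a', b'}"
    by (simp only: insert_commute)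
  also have "\<dots> \<longleftrightarrow> {a, b} = {a', b'}"
    using assms True by (intro insert_ident) auto
  finally show ?thesis
    using True by (simp add: arrow_def doubleton_eq_iff)
qed (simp add: arrow_def)

lemma contains_copy_H1_iff:
  assumes "two_one_graph H"
  shows "contains_copy H H\<^sub>1 \<longleftrightarrow>
    (\<exists>a b c d x. distinct [a, b, c, d, x] \<and> arrow a x b \<in> edges H \<and> arrow c x d \<in> edges H)"
proof
  assume "contains_copy H H\<^sub>1"
  then obtain \<phi> where \<phi>: "inj_on \<phi> {0, 1, 2, 3, 4}"
    "\<And>a b c. arrow a b c \<in> edges H\<^sub>1 \<Longrightarrow> arrow (\<phi> a) (\<phi> b) (\<phi> c) \<in> edges H"
    by (auto simp: contains_copy_def H\<^sub>1_def)
  have "distinct [\<phi> 0, \<phi> 1, \<phi> 2, \<phi> 3, \<phi> 4]"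
    using \<phi>(1) by (simp add: inj_on_def)
  moreover have "arrow (\<phi> 0) (\<phi> 4) (\<phi> 1) \<in> edges H" "arrow (\<phi> 2) (\<phi> 4) (\<phi> 3) \<in> edges H"
    by (rule \<phi>(2), simp add: H\<^sub>1_def)+
  ultimately show "\<exists>a b c d x. distinct [a, b, c, d, x] \<and>
      arrow a x b \<in> edges H \<and> arrow c x d \<in> edges H"
    by blast
next
  assume "\<exists>a b c d x. distinct [a, b, c, d, x] \<and> arrow a x b \<in> edges H \<and> arrow c x d \<in> edges H"
  then obtain a b c d x where dist: "distinct [a, b, c, d, x]"
    and e: "arrow a x b \<in> edges H" "arrow c x d \<in> edges H"
    by blast
  define \<phi> :: "nat \<Rightarrow> 'a" where "\<phi> i = [a, b, c, d, x] ! i" for i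
  have \<phi>: "\<phi> 0 = a" "\<phi> 1 = b" "\<phi> 2 = c" "\<phi> 3 = d" "\<phi> 4 = x"
    by (simp_all add: \<phi>_def)
  have "{a, x, b} \<subseteq> verts H" "{c, x, d} \<subseteq> verts H"
    using assms e by (auto simp: two_one_graph_def arrow_def)
  then have "\<phi> ` verts H\<^sub>1 \<subseteq> verts H"
    by (auto simp: H\<^sub>1_def \<phi> simp flip: One_nat_def)
  moreover have "inj_on \<phi> (verts H\<^sub>1)"
    using dist by (auto simp: H\<^sub>1_def \<phi> simp flip: One_nat_def)
  moreover have "arrow (\<phi> u) (\<phi> v) (\<phi> w) \<in> edges H" if "arrow u v w \<in> edges H\<^sub>1" for u v w
  proof -
    \<comment> \<open>An edge remembers its tails only as a set. Once the head is known to differ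
      from both tails, the edge fixes \<open>u\<close>, \<open>v\<close>, \<open>w\<close> up to
      exchanging the tails.\<close>
    have "card {u, v, w} = 3"
      using that two_one_graph_H1 by (auto simp: two_one_graph_def arrow_def)
    then have ne: "u \<noteq> w" "v \<noteq> w"
      by (auto simp: card_insert_if split: if_splits)
    have "arrow u v w = arrow 0 4 1 \<or> arrow u v w = arrow 2 4 3"
      using that by (simp add: H\<^sub>1_def)
    then show ?thesis
      using e ne by (auto simp: arrow_eq_iff \<phi> arrow_commute[of x] simp flip: One_nat_def)
  qed
  ultimately show "contains_copy H H\<^sub>1"
    unfolding contains_copy_def by blast
qed

text \<open>This is the fact that pairwise intersecting edges of a simple graph form a star or a
  triangle, applied after forgetting directions (\<open>G\<close>).\<close>

lemma intersecting_arcs_star_or_triangle: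
  assumes irrefl: "\<And>a b. (a, b) \<in> D \<Longrightarrow> a \<noteq> b"
    and int: "\<And>a b c d. (a, b) \<in> D \<Longrightarrow> (c, d) \<in> D \<Longrightarrow> {a, b} \<inter> {c, d} \<noteq> {}"
  obtains (star) y where "\<And>a b. (a, b) \<in> D \<Longrightarrow> a = y \<or> b = y"
  | (triangle) p q r where "D \<subseteq> {(p, q), (q, p), (p, r), (r, p), (q, r), (r, q)}"
proof (cases "\<exists>y. \<forall>a b. (a, b) \<in> D \<longrightarrow> a = y \<or> b = y")
  case True
  with star show thesis by blast
next
  case False
  define G where "G a b \<longleftrightarrow> (a, b) \<in> D \<or> (b, a) \<in> D" for a b
  have G_sym: "G a b \<Longrightarrow> G b a" for a b by (auto simp: G_def)
  have G_ne: "G a b \<Longrightarrow> a \<noteq> b" for a b using irrefl by (auto simp: G_def)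
  have G_int: "G a b \<Longrightarrow> G c d \<Longrightarrow> a = c \<or> a = d \<or> b = c \<or> b = d" for a b c d
    using int by (fastforce simp: G_def)
  have no_star: "\<exists>a b. G a b \<and> a \<noteq> y \<and> b \<noteq> y" for y
    using False unfolding G_def by blast
  obtain p q where pq: "G p q" using no_star by blast
  \<comment> \<open>An edge avoiding \<open>p\<close> meets \<open>pq\<close> in \<open>q\<close>;
    below, an edge avoiding \<open>q\<close> must join \<open>p\<close> to \<open>r\<close>. An edge
    meeting all three sides of the triangle is one of them.\<close>
  obtain r where qr: "G q r" "r \<noteq> p"
    using no_star[of p] G_int[OF pq] G_sym by metis
  have pr: "G p r"
    using no_star[of q] G_int[OF pq] G_int[OF qr(1)] G_sym qr(2) by metis
  have "D \<subseteq> {(p, q), (q, p), (p, r), (r, p), (q, r), (r, q)}"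
  proof (rule subrelI)
    fix a b assume ab: "(a, b) \<in> D"
    then have "G a b" by (simp add: G_def)
    with G_int[OF this pq] G_int[OF this qr(1)] G_int[OF this pr] G_ne[OF this]
      G_ne[OF pq] G_ne[OF qr(1)] qr(2)
    show "(a, b) \<in> {(p, q), (q, p), (p, r), (r, p), (q, r), (r, q)}"
      by simp metis
  qed
  with triangle show thesis by blast
qed

section \<open>Links of an \<open>H\<^sub>1\<close>-free graph\<close>

locale H1_free_graph =
  fixes H :: "'a hypergraph"
  assumes graph: "two_one_graph H"
    and free: "free_of H H\<^sub>1"
    and large: "card (verts H) \<ge> 7"
begin

definition link :: "'a \<Rightarrow> ('a \<times> 'a) set" where
  "link x = {(a, b). arrow a x b \<in> edges H}"

lemma finite_verts: "finite (verts H)"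
  using graph by (simp add: two_one_graph_def)

lemma link_memD:
  assumes "(a, b) \<in> link x"
  shows "a \<in> verts H" "b \<in> verts H" "x \<in> verts H" "a \<noteq> b" "a \<noteq> x" "b \<noteq> x"
proof -
  have *: "{a, x, b} \<subseteq> verts H" "card {a, x, b} = 3"
    using assms graph by (auto simp: link_def two_one_graph_def arrow_def)
  then show "a \<in> verts H" "b \<in> verts H" "x \<in> verts H" by auto
  show "a \<noteq> b" "a \<noteq> x" "b \<noteq> x"
    using *(2) by (auto simp: card_insert_if split: if_splits)
qed

text \<open>Tails are unordered, so an edge shows up in the links of both its tails. This is how one
  link constrains another.\<close>

lemma link_swap: "(a, b) \<in> link x \<longleftrightarrow> (x, b) \<in> link a"
  by (simp add: link_def arrow_commute)

lemma link_int:
  assumes "(a, b) \<in> link x" "(c, d) \<in> link x"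
  shows "{a, b} \<inter> {c, d} \<noteq> {}"
proof
  assume "{a, b} \<inter> {c, d} = {}"
  then have "distinct [a, b, c, d, x]"
    using link_memD[OF assms(1)] link_memD[OF assms(2)] by auto
  with assms free show False
    unfolding contains_copy_H1_iff[OF graph] link_def by blast
qed

lemma link_subset: "link x \<subseteq> verts H \<times> verts H"
  using link_memD by auto

lemma finite_link: "finite (link x)"
  by (rule finite_subset[OF link_subset]) (simp add: finite_verts)

lemma two_card_edges_le: "2 * card (edges H) \<le> (\<Sum>x\<in>verts H. card (link x))"
proof -
  define g where "g = (\<lambda>(x, a, b). arrow (a::'a) x b)"
  let ?A = "Sigma (verts H) link"
  have finA: "finite ?A" by (simp add: finite_verts finite_link)
  have gA: "g ` ?A \<subseteq> edges H" by (auto simp: g_def link_def)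
  have "edges H \<subseteq> Pow (verts H) \<times> verts H"
    using graph by (auto simp: two_one_graph_def)
  then have finE: "finite (edges H)"
    by (rule finite_subset) (simp add: finite_verts)
  \<comment> \<open>Either tail of \<open>e\<close> can play the role of \<open>x\<close>.\<close>
  have fibre: "2 \<le> card {t \<in> ?A. g t = e}" if "e \<in> edges H" for e
  proof -
    obtain S h where e: "e = (S, h)" by fastforce
    have S: "card S = 3" "h \<in> S"
      using that graph by (auto simp: e two_one_graph_def)
    then have "card (S - {h}) = 2" by simp
    then obtain a x where ax: "S - {h} = {a, x}" "a \<noteq> x" by (auto simp: card_2_iff)
    have "arrow a x h = e" using ax S by (auto simp: arrow_def e)
    then have sub: "{(x, a, h), (a, x, h)} \<subseteq> {t \<in> ?A. g t = e}"
      using that link_memD[of a h x] link_memD[of x h a]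
      by (auto simp: g_def link_def arrow_commute)
    have "card {(x, a, h), (a, x, h)} = 2" using ax by simp
    with card_mono[OF _ sub] finA show ?thesis by simp
  qed
  have "2 * card (edges H) = (\<Sum>e\<in>edges H. 2)" by simp
  also have "\<dots> \<le> (\<Sum>e\<in>edges H. card {t \<in> ?A. g t = e})" by (intro sum_mono fibre)
  also have "\<dots> = card ?A"
    using sum.group[OF finA finE gA, of "\<lambda>_. 1::nat"] by simp
  also have "\<dots> = (\<Sum>x\<in>verts H. card (link x))"
    by (simp add: finite_verts finite_link card_SigmaI)
  finally show ?thesis .
qed

section \<open>Star centres and reciprocation\<close>

definition centre_of :: "'a \<Rightarrow> 'a \<Rightarrow> bool" where
  "centre_of x y \<longleftrightarrow> y \<in> verts H - {x} \<and> (\<forall>a b. (a, b) \<in> link x \<longrightarrow> a = y \<or> b = y)"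

definition stars :: "'a set" where
  "stars = {x \<in> verts H. \<exists>y. centre_of x y}"

text \<open>A link that is empty or lives on a single pair has several possible centres; one is
  fixed here, and reciprocation refers to this choice.\<close>

definition centre :: "'a \<Rightarrow> 'a" where
  "centre x = (SOME y. centre_of x y)"

definition reciprocated :: "'a set" where
  "reciprocated = {x \<in> stars. centre x \<in> stars \<and> centre (centre x) = x}"

lemma centre:
  assumes "x \<in> stars"
  shows "centre x \<in> verts H" "centre x \<noteq> x"
    "\<And>a b. (a, b) \<in> link x \<Longrightarrow> a = centre x \<or> b = centre x"
proof -
  have "centre_of x (centre x)"
    using assms unfolding stars_def centre_def by (auto intro: someI)
  then show "centre x \<in> verts H" "centre x \<noteq> x"
    "\<And>a b. (a, b) \<in> link x \<Longrightarrow> a = centre x \<or> b = centre x"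
    by (auto simp: centre_of_def)
qed

lemma reciprocatedD:
  assumes "x \<in> reciprocated"
  shows "x \<in> stars" "centre (centre x) = x" "centre x \<in> reciprocated" "x \<in> verts H"
  using assms by (auto simp: reciprocated_def stars_def)

lemma not_star_triangle:
  assumes "x \<in> verts H" "x \<notin> stars"
  obtains p q r where "link x \<subseteq> {(p, q), (q, p), (p, r), (r, p), (q, r), (r, q)}"
proof (rule intersecting_arcs_star_or_triangle[of "link x"])
  fix y assume y: "\<And>a b. (a, b) \<in> link x \<Longrightarrow> a = y \<or> b = y"
  have "\<exists>z. centre_of x z"
  \<comment> \<open>An empty link counts as a star around any other vertex.\<close>
  proof (cases "link x = {}")
    case True
    have "card (verts H - {x}) > 0" using large by (simp add: assms)
    then obtain z where "z \<in> verts H - {x}" by (metis card_gt_0_iff ex_in_conv)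
    with True show ?thesis by (auto simp: centre_of_def)
  next
    case False
    then obtain a b where ab: "(a, b) \<in> link x" by auto
    then have "y \<in> verts H - {x}" using y[OF ab] link_memD[OF ab] by auto
    with y show ?thesis by (auto simp: centre_of_def)
  qed
  with assms show thesis by (simp add: stars_def)
qed (erule link_memD(4) | erule (1) link_int | erule that)+

section \<open>Bounds for a single link\<close>

lemma card_le_6: "card {p, q, r, s, t, u} \<le> 6"
  using card_length[of "[p, q, r, s, t, u]"] by simp

lemma card_link_not_star:
  assumes "x \<in> verts H" "x \<notin> stars"
  shows "card (link x) \<le> 6"
proof -
  obtain p q r where "link x \<subseteq> {(p, q), (q, p), (p, r), (r, p), (q, r), (r, q)}"
    using not_star_triangle[OF assms] .
  then have "card (link x) \<le> card {(p, q), (q, p), (p, r), (r, p), (q, r), (r, q)}"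
    by (intro card_mono) simp_all
  then show ?thesis using card_le_6 by (rule le_trans)
qed

text \<open>The neighbours meant are those of \<open>centre x\<close> within \<open>link x\<close>;
  a star link splits into arcs into and arcs out of its centre.\<close>

definition in_nbrs :: "'a \<Rightarrow> 'a set" where
  "in_nbrs x = {a. (a, centre x) \<in> link x}"

definition out_nbrs :: "'a \<Rightarrow> 'a set" where
  "out_nbrs x = {b. (centre x, b) \<in> link x}"

lemma card_verts_minus_2:
  assumes "x \<in> stars"
  shows "card (verts H - {x, centre x}) = card (verts H) - 2"
  using assms centre[OF assms] by (subst card_Diff_subset) (auto simp: stars_def)

lemma in_nbrs_subset: "in_nbrs x \<subseteq> verts H - {x, centre x}"
  by (auto simp: in_nbrs_def dest: link_memD)

lemma out_nbrs_subset: "out_nbrs x \<subseteq> verts H - {x, centre x}"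
  by (auto simp: out_nbrs_def dest: link_memD)

lemma finite_nbrs: "finite (in_nbrs x)" "finite (out_nbrs x)"
  by (rule finite_subset[OF in_nbrs_subset] finite_subset[OF out_nbrs_subset],
      simp add: finite_verts)+

lemma card_in_nbrs:
  assumes "x \<in> stars"
  shows "card (in_nbrs x) \<le> card (verts H) - 2"
  unfolding card_verts_minus_2[OF assms, symmetric]
  by (intro card_mono in_nbrs_subset) (simp add: finite_verts)

lemma card_out_nbrs:
  assumes "x \<in> stars"
  shows "card (out_nbrs x) \<le> card (verts H) - 2"
  unfolding card_verts_minus_2[OF assms, symmetric]
  by (intro card_mono out_nbrs_subset) (simp add: finite_verts)

lemma card_link_star:
  assumes "x \<in> stars"
  shows "card (link x) \<le> card (in_nbrs x) + card (out_nbrs x)"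
proof -
  have "link x \<subseteq> (\<lambda>a. (a, centre x)) ` in_nbrs x \<union> Pair (centre x) ` out_nbrs x"
    using centre(3)[OF assms] by (fastforce simp: in_nbrs_def out_nbrs_def)
  then have "card (link x) \<le> card ((\<lambda>a. (a, centre x)) ` in_nbrs x \<union> Pair (centre x) ` out_nbrs x)"
    by (intro card_mono) (simp_all add: finite_nbrs)
  also have "\<dots> \<le> card ((\<lambda>a. (a, centre x)) ` in_nbrs x) + card (Pair (centre x) ` out_nbrs x)"
    by (rule card_Un_le)
  also have "\<dots> \<le> card (in_nbrs x) + card (out_nbrs x)"
    by (intro add_mono card_image_le finite_nbrs)
  finally show ?thesis .
qed

lemma card_out_nbrs_le_1:
  assumes "x \<in> stars" "centre x \<in> stars" "x \<notin> reciprocated"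
  shows "card (out_nbrs x) \<le> 1"
proof -
  have "out_nbrs x \<subseteq> {centre (centre x)}"
  proof
    fix b assume "b \<in> out_nbrs x"
    then have "(x, b) \<in> link (centre x)" using link_swap by (auto simp: out_nbrs_def)
    then have "x = centre (centre x) \<or> b = centre (centre x)" by (rule centre(3)[OF assms(2)])
    with assms show "b \<in> {centre (centre x)}" by (auto simp: reciprocated_def)
  qed
  from card_mono[OF _ this] show ?thesis by simp
qed

lemma card_out_nbrs_le_2:
  assumes "x \<in> stars" "centre x \<notin> stars"
  shows "card (out_nbrs x) \<le> 2"
proof -
  obtain p q r
    where pqr: "link (centre x) \<subseteq> {(p, q), (q, p), (p, r), (r, p), (q, r), (r, q)}"
    using not_star_triangle[OF centre(1)[OF assms(1)] assms(2)] .
  \<comment> \<open>By \<open>link_swap\<close>, \<open>b\<close> is an out-neighbour iff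
    \<open>x \<rightarrow> b\<close> is an arc of the triangle; then \<open>x\<close> is one corner
    and \<open>b\<close> one of the other two.\<close>
  have sub: "out_nbrs x \<subseteq> {p, q, r} - {x}" and x: "out_nbrs x \<noteq> {} \<Longrightarrow> x \<in> {p, q, r}"
    using pqr by (auto simp: out_nbrs_def link_swap[of "centre x"] dest: link_memD(4,5))
  show ?thesis
  proof (cases "out_nbrs x = {}")
    case False
    have "card (out_nbrs x) \<le> card ({p, q, r} - {x})"
      using sub by (intro card_mono) simp_all
    also have "\<dots> = card {p, q, r} - 1"
      using x[OF False] by (rule card_Diff_singleton)
    also have "\<dots> \<le> 2"
      using card_length[of "[p, q, r]"] by simp
    finally show ?thesis .
  qed simp
qed

text \<open>Otherwise \<open>x \<rightarrow> centre x\<close> would be an arc of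
  \<open>link u\<close>, so \<open>centre u\<close>, itself reciprocated, would be \<open>x\<close>
  or \<open>centre x\<close>.\<close>

lemma in_nbrs_avoid_reciprocated:
  assumes "x \<in> stars" "x \<notin> reciprocated" "centre x \<notin> reciprocated" "u \<in> reciprocated"
  shows "u \<notin> in_nbrs x"
proof
  assume "u \<in> in_nbrs x"
  then have "(x, centre x) \<in> link u" using link_swap by (auto simp: in_nbrs_def)
  then have "x = centre u \<or> centre x = centre u" by (rule centre(3)[OF reciprocatedD(1)[OF assms(4)]])
  with assms reciprocatedD(3)[OF assms(4)] show False by auto
qed

lemma card_link_le:
  assumes "x \<in> verts H" "x \<notin> reciprocated"
  shows "card (link x) \<le> card (verts H)"
proof (cases "x \<in> stars")
  case True
  have "card (out_nbrs x) \<le> 2"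
    using True assms card_out_nbrs_le_1[of x] card_out_nbrs_le_2[of x]
    by (cases "centre x \<in> stars") simp_all
  with card_link_star[OF True] card_in_nbrs[OF True] large show ?thesis by linarith
next
  case False
  then have "card (link x) \<le> 6" using assms(1) by (intro card_link_not_star)
  with large show ?thesis by linarith
qed

lemma card_link_le':
  assumes "x \<in> verts H" "x \<notin> reciprocated" "reciprocated \<noteq> {}"
  shows "card (link x) \<le> card (verts H) - 1"
proof (cases "x \<in> stars")
  case star: True
  show ?thesis
  proof (cases "centre x \<in> stars")
    case True
    with card_link_star[OF star] card_in_nbrs[OF star] card_out_nbrs_le_1[of x] star assms large
    show ?thesis by simp
  next
    case False
    then have cx: "centre x \<notin> reciprocated" by (auto simp: reciprocated_def)
    obtain u where u: "u \<in> reciprocated" using assms by blast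
    note u' = reciprocatedD[OF u]
    \<comment> \<open>Both \<open>u\<close> and its partner are excluded, which leaves at most
      \<open>(n - 4) + 2\<close> arcs.\<close>
    have "in_nbrs x \<subseteq> verts H - {x, centre x, u, centre u}"
      using in_nbrs_subset[of x] in_nbrs_avoid_reciprocated[OF star assms(2) cx] u u'(3) by blast
    moreover have "card (verts H - {x, centre x, u, centre u}) = card (verts H) - 4"
    proof -
      have neq: "x \<noteq> u" "x \<noteq> centre u" "centre x \<noteq> u" "centre x \<noteq> centre u"
        using u u'(3) assms(2) cx by metis+
      have "card {x, centre x, u, centre u} = 4"
        using centre(2)[OF star] centre(2)[OF u'(1)] neq by simp
      moreover have "{x, centre x, u, centre u} \<subseteq> verts H"
        using assms(1) centre(1)[OF star] centre(1)[OF u'(1)] u'(4) by simp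
      ultimately show ?thesis by (subst card_Diff_subset) auto
    qed
    ultimately have "card (in_nbrs x) \<le> card (verts H) - 4"
      using card_mono[of "verts H - {x, centre x, u, centre u}" "in_nbrs x"] finite_verts by simp
    with card_link_star[OF star] card_out_nbrs_le_2[OF star False] large show ?thesis by linarith
  qed
next
  case False
  \<comment> \<open>The 7 in \<open>large\<close> makes these 6 arcs at most
    \<open>n - 1\<close>.\<close>
  then have "card (link x) \<le> 6" using assms(1) by (intro card_link_not_star)
  with large show ?thesis by linarith
qed

section \<open>Summation over all vertices\<close>

lemma sum_card_in_nbrs_reciprocated:
  "(\<Sum>x\<in>reciprocated. card (in_nbrs x)) \<le> 2 * card (verts H - reciprocated)"
proof -
  let ?R = reciprocated
  define B where "B b = {x \<in> ?R. (x, centre x) \<in> link b}" for b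
  have finR: "finite ?R" using reciprocatedD(4) finite_verts by (meson finite_subset subsetI)
  \<comment> \<open>This permits double counting: the sum is regrouped by the vertex
    \<open>b\<close> whose link contains \<open>x \<rightarrow> centre x\<close>.\<close>
  have in_nbrs: "in_nbrs x = {b \<in> verts H. (x, centre x) \<in> link b}" for x
    using link_memD link_swap by (auto simp: in_nbrs_def)
  have "(\<Sum>x\<in>?R. card (in_nbrs x)) = (\<Sum>b\<in>verts H. card (B b))"
    unfolding B_def in_nbrs
    using sum_multicount_gen[OF finR finite_verts, of "\<lambda>x b. (x, centre x) \<in> link b"] by simp
  also have "\<dots> = (\<Sum>b\<in>verts H - ?R. card (B b))"
  proof (rule sum.mono_neutral_right[OF finite_verts])
    show "\<forall>b\<in>verts H - (verts H - ?R). card (B b) = 0"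
    proof
      fix b assume "b \<in> verts H - (verts H - ?R)"
      then have b: "b \<in> ?R" by blast
      \<comment> \<open>For reciprocated \<open>b\<close> the arc must contain
        \<open>centre b\<close>; applying \<open>centre\<close> puts \<open>b\<close> itself on the
        arc.\<close>
      have False if x: "x \<in> ?R" "(x, centre x) \<in> link b" for x
      proof -
        have "x = centre b \<or> centre x = centre b"
          using centre(3)[OF reciprocatedD(1)[OF b]] x(2) .
        then have "b = centre x \<or> b = x"
          using reciprocatedD(2)[OF b] reciprocatedD(2)[OF x(1)] by metis
        with link_memD[OF x(2)] show False by auto
      qed
      then have "B b = {}" by (auto simp: B_def)
      then show "card (B b) = 0" by simp
    qed
  qed auto
  also have "\<dots> \<le> (\<Sum>b\<in>verts H - ?R. 2)"
  proof (rule sum_mono)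
    fix b
    show "card (B b) \<le> 2"
    proof (cases "B b = {}")
      case False
      then obtain x where x: "x \<in> ?R" "(x, centre x) \<in> link b" by (auto simp: B_def)
      \<comment> \<open>Two such arcs intersect, and \<open>centre\<close> is an involution on
        \<open>?R\<close>, so they span the same pair.\<close>
      have "B b \<subseteq> {x, centre x}"
      proof
        fix y assume "y \<in> B b"
        then have y: "y \<in> ?R" "(y, centre y) \<in> link b" by (auto simp: B_def)
        have "x = y \<or> x = centre y \<or> centre x = y \<or> centre x = centre y"
          using link_int[OF x(2) y(2)] by blast
        then show "y \<in> {x, centre x}"
          using reciprocatedD(2)[OF x(1)] reciprocatedD(2)[OF y(1)] by (metis insert_iff)
      qed
      then have "card (B b) \<le> card (set [x, centre x])" by (intro card_mono) auto
      also have "\<dots> \<le> 2" using card_length[of "[x, centre x]"] by simp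
      finally show ?thesis .
    qed simp
  qed
  also have "\<dots> = 2 * card (verts H - ?R)" by simp
  finally show ?thesis .
qed

lemma sum_card_link_le: "(\<Sum>x\<in>verts H. card (link x)) + 6 \<le> card (verts H) * (card (verts H) + 1)"
proof (cases "reciprocated = {}")
  case True
  have "(\<Sum>x\<in>verts H. card (link x)) \<le> card (verts H) * card (verts H)"
    using sum_bounded_above[of "verts H" "\<lambda>x. card (link x)" "card (verts H)"] card_link_le True by simp
  with large show ?thesis by simp
next
  case False
  let ?R = reciprocated
  have sub: "?R \<subseteq> verts H" using reciprocatedD(4) by blast
  then have finR: "finite ?R" using finite_verts finite_subset by blast
  obtain u where u: "u \<in> ?R" using False by blast
  \<comment> \<open>The bounds below add up to \<open>n * (n + 1) - 3 * r\<close>; a reciprocated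
    vertex comes with its partner, so at least 6 is saved.\<close>
  have "card {u, centre u} \<le> card ?R"
    using u reciprocatedD(3)[OF u] by (intro card_mono finR) auto
  then have r2: "card ?R \<ge> 2"
    using centre(2)[OF reciprocatedD(1)[OF u]] by auto
  define m r where "m = card (verts H - ?R)" and "r = card ?R"
  have n: "card (verts H) = m + r"
    using card_Diff_subset[OF finR sub] card_mono[OF finite_verts sub]
    by (simp add: m_def r_def)
  have "(\<Sum>x\<in>?R. card (link x)) \<le> (\<Sum>x\<in>?R. card (in_nbrs x) + (m + r - 2))"
  proof (rule sum_mono)
    fix x assume "x \<in> ?R"
    then have "x \<in> stars" by (rule reciprocatedD(1))
    from card_link_star[OF this] card_out_nbrs[OF this]
    show "card (link x) \<le> card (in_nbrs x) + (m + r - 2)" by (simp add: n)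
  qed
  also have "\<dots> \<le> 2 * m + r * (m + r - 2)"
    using sum_card_in_nbrs_reciprocated by (simp add: sum.distrib m_def r_def)
  finally have R: "(\<Sum>x\<in>?R. card (link x)) \<le> 2 * m + r * (m + r - 2)" .
  have N: "(\<Sum>x\<in>verts H - ?R. card (link x)) \<le> m * (m + r - 1)"
    using sum_bounded_above[of "verts H - ?R" "\<lambda>x. card (link x)" "card (verts H) - 1"]
      card_link_le' False by (simp add: n flip: m_def)
  \<comment> \<open>This removes the truncated subtractions.\<close>
  obtain s where s: "r = s + 2" using r2 by (metis le_add_diff_inverse2 r_def)
  have "(\<Sum>x\<in>verts H. card (link x))
      = (\<Sum>x\<in>verts H - ?R. card (link x)) + (\<Sum>x\<in>?R. card (link x))"
    by (rule sum.subset_diff[OF sub finite_verts])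
  with R N show ?thesis by (simp add: n s algebra_simps)
qed

lemma card_edges_le: "card (edges H) \<le> (card (verts H) + 1 choose 2) - 3"
  using two_card_edges_le sum_card_link_le by (simp add: choose_two mult.commute)

end

section \<open>The extremal graph\<close>

lemma free_of_H1_if_common_vertices:
  assumes "two_one_graph H"
    and v: "\<And>S h. (S, h) \<in> edges H \<Longrightarrow> v \<in> S"
    and w: "\<And>S h. (S, h) \<in> edges H \<Longrightarrow> h \<noteq> v \<Longrightarrow> w \<in> S"
    and "v \<noteq> w"
  shows "free_of H H\<^sub>1"
proof
  assume "contains_copy H H\<^sub>1"
  then obtain a b c d x where dist: "distinct [a, b, c, d, x]"
    and e: "({a, x, b}, b) \<in> edges H" "({c, x, d}, d) \<in> edges H"
    unfolding contains_copy_H1_iff[OF assms(1)] arrow_def by blast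
  \<comment> \<open>The two edges share only \<open>x\<close>. As \<open>x\<close> is a tail of
    both, neither head is \<open>v\<close>, so \<open>w\<close> would be a second common
    vertex.\<close>
  from v[OF e(1)] v[OF e(2)] dist have "x = v" by auto
  with w[OF e(1)] w[OF e(2)] dist \<open>v \<noteq> w\<close> show False by auto
qed

lemma ex_extremal_graph:
  assumes "n \<ge> 2"
  shows "\<exists>H :: nat hypergraph. two_one_graph H \<and> card (verts H) = n \<and> free_of H H\<^sub>1 \<and>
    card (edges H) = (n + 1 choose 2) - 3"
proof -
  \<comment> \<open>Here \<open>v = 0\<close> and \<open>w = 1\<close>. The heads are 0 in
    \<open>A\<close>, at least 2 in \<open>B\<close> and 1 in \<open>C\<close>, so the three
    families are disjoint.\<close>
  define A where "A = (\<lambda>S. (insert (0::nat) S, 0::nat)) ` {S. S \<subseteq> {1..<n} \<and> card S = 2}"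
  define B where "B = (\<lambda>b. arrow (0::nat) 1 b) ` {2..<n}"
  define C where "C = (\<lambda>b. arrow (0::nat) b 1) ` {2..<n}"
  define H where "H = \<lparr> verts = {..<n}, edges = A \<union> B \<union> C \<rparr>"
  have graph: "two_one_graph H"
  proof -
    have "card (insert 0 S) = 3" if "S \<subseteq> {1..<n}" "card S = 2" for S
      using that finite_subset[OF that(1)] by (subst card_insert_disjoint) auto
    with assms show ?thesis
      by (fastforce simp: two_one_graph_def H_def A_def B_def C_def arrow_def)
  qed
  moreover have "free_of H H\<^sub>1"
    by (rule free_of_H1_if_common_vertices[OF graph, of 0 1])
      (auto simp: H_def A_def B_def C_def arrow_def)
  moreover have "card (edges H) = (n + 1 choose 2) - 3"
  proof -
    have "card A = card {S. S \<subseteq> {1..<n} \<and> card S = 2}"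
      unfolding A_def
    proof (intro card_image inj_onI)
      fix S T assume "S \<in> {S. S \<subseteq> {1..<n} \<and> card S = 2}" "T \<in> {S. S \<subseteq> {1..<n} \<and> card S = 2}"
        and eq: "(insert 0 S, 0::nat) = (insert 0 T, 0)"
      then have "0 \<notin> S" "0 \<notin> T" by auto
      with eq show "S = T" by (simp add: insert_ident)
    qed
    then have A: "card A = (n - 1 choose 2)" by (simp add: n_subsets)
    have B: "card B = n - 2"
      unfolding B_def by (subst card_image) (auto simp: inj_on_def arrow_def)
    have C: "card C = n - 2"
      unfolding C_def by (subst card_image) (auto simp: inj_on_def arrow_eq_iff)
    have fin: "finite A" "finite B" "finite C"
      by (simp_all add: A_def B_def C_def)
    have "snd t = 0" if "t \<in> A" for t using that by (auto simp: A_def)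
    moreover have "snd t \<ge> 2" if "t \<in> B" for t using that by (auto simp: B_def arrow_def)
    moreover have "snd t = 1" if "t \<in> C" for t using that by (auto simp: C_def arrow_def)
    ultimately have disj: "A \<inter> B = {}" "(A \<union> B) \<inter> C = {}"
      by fastforce+
    have "card (edges H) = card (A \<union> B) + card C"
      unfolding H_def using fin disj by (simp add: card_Un_disjoint)
    also have "card (A \<union> B) = card A + card B"
      using fin disj by (simp add: card_Un_disjoint)
    finally have "card (edges H) = (n - 1 choose 2) + 2 * (n - 2)"
      by (simp add: A B C)
    \<comment> \<open>With \<open>n = k + 2\<close> the claim is
      \<open>(k + 1 choose 2) + 2 * k = (k + 3 choose 2) - 3\<close>, which Pascal's rule
      settles.\<close>
    moreover obtain k where "n = k + 2"
      using assms by (metis le_add_diff_inverse2)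
    ultimately show ?thesis
      by (simp add: numeral_2_eq_2)
  qed
  ultimately show ?thesis
    by (intro exI[of _ H]) (simp add: H_def)
qed

theorem theorem4p2:
  fixes n :: nat
  assumes "n \<ge> 8"
  shows "ex n H\<^sub>1 = (n + 1 choose 2) - 3"
  unfolding ex_def
proof (rule Max_eqI[OF finite_edge_counts])
  fix m
  assume "m \<in> {card (edges H) | H :: nat hypergraph.
    two_one_graph H \<and> card (verts H) = n \<and> free_of H H\<^sub>1}"
  then obtain H :: "nat hypergraph" where
    H: "m = card (edges H)" "two_one_graph H" "card (verts H) = n" "free_of H H\<^sub>1"
    by blast
  interpret H1_free_graph H
    by unfold_locales (use H assms in auto)
  show "m \<le> (n + 1 choose 2) - 3"
    using card_edges_le H by simp
next
  show "(n + 1 choose 2) - 3 \<in> {card (edges H) | H :: nat hypergraph.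
    two_one_graph H \<and> card (verts H) = n \<and> free_of H H\<^sub>1}"
    using ex_extremal_graph[of n] assms by force
qed

end
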